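(* Let $q$ be a complex number with $0<|q|<1$, and let $a,b,c,d,e$ be complex numbers satisfying $0<|cde|<|abq|$ and $c,d,e\neq -aq^{-m},\,-bq^{-n}$ for all integers $n,m\geq 0$. Define $$\rho(a,b;c,d,e)=\sum_{k=0}^{\infty}\left(1-\frac{aq^{2k+1}}{b}\right)\frac{(-1/b;q)_{k+1}}{(-c/b,-d/b,-e/b;q)_{k+1}}\cdot\frac{(-aq/c,-aq/d,-aq/e;q)_k}{(-aq;q)_k}\left(\frac{cde}{abq}\right)^k,$$ and $\rho(b,a;c,d,e)$ by the same formula with $a$ and $b$ interchanged. Then $$\rho(a,b;c,d,e)-\rho(b,a;c,d,e)=\left(\frac{1}{b}-\frac{1}{a}\right)\frac{(q,aq/b,bq/a,c,d,e,cd/(ab),ce/(ab),de/(ab);q)_\infty}{(-aq,-bq,-c/a,-c/b,-d/a,-d/b,-e/a,-e/b,cde/(abq);q)_\infty}.$$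
   Context: For complex $x$ and integer $n\ge 0$: $(x;q)_\infty=\prod_{j=0}^{\infty}(1-xq^j)$, $(x;q)_n=(x;q)_\infty/(xq^n;q)_\infty$, and $(x_1,\dots,x_m;q)_n=(x_1;q)_n\cdots(x_m;q)_n$ (similarly for $n=\infty$).
   Formalization: The formal statement also assumes a, b ≠ -q^{-n} for all n ≥ 1, since otherwise (-aq;q)_k or (-bq;q)_k vanishes in a denominator and the series and the right-hand side are undefined; (x;q)_n is read as the finite product. *)

theory Defs
  imports "HOL-Analysis.Analysis"
begin

definition qpoch_inf :: "complex \<Rightarrow> complex \<Rightarrow> complex" where
  "qpoch_inf x q = (\<Prod>j. 1 - x * q ^ j)"

text \<open>
  The quotient \<open>(x;q)\<^sub>\<infinity> / (x q\<^sup>n;q)\<^sub>\<infinity>\<close> has the form \<open>0/0\<close> when \<open>x = q\<^bsup>-m\<^esup>\<close> with \<open>m \<ge> n\<close>.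
  The finite product is its continuous extension; away from those points the two agree
  (lemma \<open>qpoch_eq_quotient\<close> below).
\<close>
definition qpoch :: "complex \<Rightarrow> complex \<Rightarrow> nat \<Rightarrow> complex" where
  "qpoch x q n = (\<Prod>j<n. 1 - x * q ^ j)"

definition qpochs :: "complex list \<Rightarrow> complex \<Rightarrow> nat \<Rightarrow> complex" where
  "qpochs xs q n = (\<Prod>x\<leftarrow>xs. qpoch x q n)"

definition qpochs_inf :: "complex list \<Rightarrow> complex \<Rightarrow> complex" where
  "qpochs_inf xs q = (\<Prod>x\<leftarrow>xs. qpoch_inf x q)"

definition rho :: "complex \<Rightarrow> complex \<Rightarrow> complex \<Rightarrow> complex \<Rightarrow> complex \<Rightarrow> complex \<Rightarrow> complex" where
  "rho q a b c d e =
     (\<Sum>k. (1 - a * q ^ (2 * k + 1) / b)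
          * (qpoch (-1 / b) q (k + 1) / qpochs [- c / b, - d / b, - e / b] q (k + 1))
          * (qpochs [- a * q / c, - a * q / d, - a * q / e] q k / qpoch (- a * q) q k)
          * (c * d * e / (a * b * q)) ^ k)"

lemma convergent_prod_qpoch:
  fixes x q :: complex
  assumes "norm q < 1"
  shows "convergent_prod (\<lambda>j. 1 - x * q ^ j)"
proof -
  have "summable (\<lambda>j. norm (- x) * norm q ^ j)"
    using assms by (intro summable_mult summable_geometric) simp
  then have "summable (\<lambda>j. norm ((1 - x * q ^ j) - 1))"
    by (simp add: norm_mult norm_power)
  then show ?thesis
    by (intro abs_convergent_prod_imp_convergent_prod summable_imp_abs_convergent_prod)
qed

lemma qpoch_eq_quotient:
  assumes "norm q < 1" and "\<And>j. x * q ^ (n + j) \<noteq> 1"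
  shows "qpoch x q n = qpoch_inf x q / qpoch_inf (x * q ^ n) q"
proof -
  let ?f = "\<lambda>j. 1 - x * q ^ j"
  have shift: "(\<lambda>j. ?f (j + n)) = (\<lambda>j. 1 - (x * q ^ n) * q ^ j)"
    by (simp add: power_add mult_ac)
  have "1 - (x * q ^ n) * q ^ j \<noteq> 0" for j
    using assms(2)[of j] by (simp add: power_add mult.assoc)
  then have nz: "qpoch_inf (x * q ^ n) q \<noteq> 0"
    unfolding qpoch_inf_def
    by (rule prodinf_nonzero[OF convergent_prod_qpoch[OF assms(1)]])
  have "qpoch_inf x q = (\<Prod>j<n. ?f j) * (\<Prod>j. ?f (j + n))"
    unfolding qpoch_inf_def
    by (rule has_prod_unique[OF has_prod_ignore_initial_segment'[OF convergent_prod_qpoch[OF assms(1)]], symmetric])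
  then have "qpoch_inf x q = qpoch x q n * qpoch_inf (x * q ^ n) q"
    unfolding shift by (simp only: qpoch_def qpoch_inf_def)
  with nz show ?thesis by simp
qed

end

theory Submission
  imports Defs
begin

text \<open>
  Put \<open>A = aq/b\<close>. Reversing the index of the second series turns \<open>\<rho>(a,b;c,d,e) - \<rho>(b,a;c,d,e)\<close> into a
  bilateral very-well-poised series, and the claim is Bailey's \<open>\<^sub>6\<psi>\<^sub>6\<close> summation with parameters
  \<open>-q/b, -aq/c, -aq/d, -aq/e\<close>. As a function of the reciprocal \<open>x\<close> of any one of the parameters the
  bilateral series satisfies a first-order \<open>q\<close>-difference equation relating \<open>x\<close> to \<open>xq\<close>: termwise it is a
  telescoping identity, and the boundary terms of the two halves cancel. Iterating it, and using Tannery's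
  theorem for the limit, replaces \<open>x\<close> by \<open>0\<close> at the cost of infinite products. Doing so for all four
  parameters leaves a theta series in \<open>A\<close>. Its product form comes from the same reduction, applied to a choice
  of parameters for which the bilateral series has a single term.
\<close>

subsection \<open>Infinite \<open>q\<close>-shifted factorials\<close>

lemma tendsto_qpoch:
  assumes "norm q < 1"
  shows "qpoch x q \<longlonglongrightarrow> qpoch_inf x q"
  using convergent_prod_LIMSEQ[OF convergent_prod_qpoch[OF assms, of x]]
  unfolding qpoch_inf_def qpoch_def by (simp add: LIMSEQ_lessThan_iff_atMost)

lemma qpoch_inf_0 [simp]: "qpoch_inf 0 q = 1"
  by (simp add: qpoch_inf_def)

lemma qpoch_inf_nonzero:
  assumes "norm q < 1" "\<And>j. x * q ^ j \<noteq> 1"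
  shows "qpoch_inf x q \<noteq> 0"
  unfolding qpoch_inf_def
  by (rule prodinf_nonzero[OF convergent_prod_qpoch[OF assms(1)]]) (use assms(2) in \<open>auto dest: sym\<close>)

lemma qpoch_Suc_left: "qpoch x q (Suc n) = (1 - x) * qpoch (x * q) q n"
  unfolding qpoch_def by (subst prod.lessThan_Suc_shift) (simp add: mult.assoc)

lemma qpoch_inf_rec:
  assumes "norm q < 1"
  shows "qpoch_inf x q = (1 - x) * qpoch_inf (x * q) q"
proof (rule LIMSEQ_unique)
  show "(\<lambda>n. qpoch x q (Suc n)) \<longlonglongrightarrow> qpoch_inf x q"
    using tendsto_qpoch[OF assms] by (rule LIMSEQ_Suc)
  show "(\<lambda>n. qpoch x q (Suc n)) \<longlonglongrightarrow> (1 - x) * qpoch_inf (x * q) q"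
    unfolding qpoch_Suc_left by (intro tendsto_intros tendsto_qpoch assms)
qed

lemma qpoch_inf_eq_0:
  assumes "norm q < 1" "x * q ^ n = 1"
  shows "qpoch_inf x q = 0"
  using assms(2)
proof (induction n arbitrary: x)
  case 0
  then show ?case using qpoch_inf_rec[OF assms(1), of x] by simp
next
  case (Suc n)
  then show ?case using qpoch_inf_rec[OF assms(1), of x] Suc.IH[of "x * q"] by (simp add: mult.assoc)
qed

lemma qpoch_add: "qpoch x q (m + n) = qpoch x q m * qpoch (x * q ^ m) q n"
proof (induction n)
  case (Suc n)
  have "qpoch x q (m + Suc n) = qpoch x q (m + n) * (1 - x * q ^ (m + n))"
    by (simp add: qpoch_def)
  also have "\<dots> = qpoch x q m * qpoch (x * q ^ m) q (Suc n)"
    unfolding Suc by (simp add: qpoch_def power_add mult.assoc)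
  finally show ?case .
qed (simp add: qpoch_def)

text \<open>\<open>qpoch (x * q ^ m) q n\<close> is a quotient of two members of the sequence
  \<open>qpoch x q\<close>. This sequence is bounded and, having no zero member and a nonzero limit,
  also bounded away from 0, so one delta serves all \<open>m\<close> and \<open>n\<close>.\<close>

lemma qpoch_shift_lower_bound:
  assumes q: "norm q < 1" and nz: "\<And>j. x * q ^ j \<noteq> 1"
  obtains \<delta> where "\<delta> > 0" "\<And>m n. norm (qpoch (x * q ^ m) q n) \<ge> \<delta>"
proof -
  have lim: "qpoch x q \<longlonglongrightarrow> qpoch_inf x q" by (rule tendsto_qpoch[OF q])
  have nz': "qpoch x q n \<noteq> 0" for n
    using nz unfolding qpoch_def by (auto dest: sym)
  have "Bseq (qpoch x q)"
    using lim by (intro convergent_imp_Bseq convergentI)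
  then obtain K where K: "K > 0" "\<And>n. norm (qpoch x q n) \<le> K"
    by (auto elim: BseqE)
  have "Bseq (\<lambda>n. inverse (qpoch x q n))"
    using tendsto_inverse[OF lim qpoch_inf_nonzero[OF q nz]]
    by (intro convergent_imp_Bseq convergentI)
  then obtain L where L: "L > 0" "\<And>n. norm (inverse (qpoch x q n)) \<le> L"
    by (auto elim: BseqE)
  have "norm (qpoch (x * q ^ m) q n) \<ge> 1 / (K * L)" for m n
  proof -
    have "1 = norm (inverse (qpoch x q (m + n))) * norm (qpoch x q (m + n))"
      using nz'[of "m + n"] by (simp add: norm_inverse)
    also have "\<dots> = norm (inverse (qpoch x q (m + n))) * norm (qpoch x q m) * norm (qpoch (x * q ^ m) q n)"
      by (simp add: qpoch_add norm_mult)
    also have "\<dots> \<le> L * K * norm (qpoch (x * q ^ m) q n)"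
      by (intro mult_right_mono mult_mono K L norm_ge_zero less_imp_le)
    finally show ?thesis using K L by (simp add: field_simps)
  qed
  then show thesis using that[of "1 / (K * L)"] K L by simp
qed

subsection \<open>Very-well-poised series\<close>

text \<open>For nonzero \<open>x\<close> this is x^n (1/x;q)_n / (Axq;q)_n. Multiplying the power of
  \<open>x\<close> into the numerator keeps the factor meaningful at \<open>x = 0\<close>.\<close>

definition well_poised_factor :: "complex \<Rightarrow> complex \<Rightarrow> complex \<Rightarrow> nat \<Rightarrow> complex" where
  "well_poised_factor q A x n = (\<Prod>j<n. (x - q ^ j) / (1 - A * x * q ^ (j + 1)))"

text \<open>
  The parameters are the reciprocals of those of the usual \<open>\<^sub>6\<psi>\<^sub>6\<close> notation, so that letting
  them tend to infinity becomes setting them to \<open>0\<close>.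
\<close>
definition vwp_weight ::
  "complex \<Rightarrow> complex \<Rightarrow> complex \<Rightarrow> complex \<Rightarrow> complex \<Rightarrow> complex \<Rightarrow> nat \<Rightarrow> complex" where
  "vwp_weight q A x y z v n =
     (q * A ^ 2) ^ n * well_poised_factor q A x n * well_poised_factor q A y n
       * well_poised_factor q A z n * well_poised_factor q A v n"

text \<open>The half with index n >= 0 of the bilateral series, without the customary division by 1
  - A.\<close>

definition vwp_sum ::
  "complex \<Rightarrow> complex \<Rightarrow> complex \<Rightarrow> complex \<Rightarrow> complex \<Rightarrow> complex \<Rightarrow> complex" where
  "vwp_sum q A x y z v = (\<Sum>n. (1 - A * q ^ (2 * n)) * vwp_weight q A x y z v n)"

text \<open>
  The second series is the part with negative index of the bilateral series. The two prefactors
  clear denominators, so that the value stays meaningful for \<open>Ax = 1\<close>, that is, for \<open>a = -1\<close> in the theorem.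
\<close>
definition bilateral_vwp ::
  "complex \<Rightarrow> complex \<Rightarrow> complex \<Rightarrow> complex \<Rightarrow> complex \<Rightarrow> complex \<Rightarrow> complex" where
  "bilateral_vwp q A x y z v =
     (1 - q * x) * (1 - q * y) * (1 - q * z) * (1 - q * v) * vwp_sum q A x y z v
     - q / A * ((1 - A * x) * (1 - A * y) * (1 - A * z) * (1 - A * v)
         * vwp_sum q (q ^ 2 / A) (x * A / q) (y * A / q) (z * A / q) (v * A / q))"

section \<open>Majorants uniform in the shift of a parameter, and symmetry\<close>

lemma well_poised_factor_eq:
  "well_poised_factor q A x n = (\<Prod>j<n. x - q ^ j) / qpoch (A * x * q) q n"
  unfolding well_poised_factor_def qpoch_def prod_dividef by (simp add: mult.assoc)

text \<open>Tannery's theorem for \<open>x * q ^ m\<close> tending to 0 needs a majorant independent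
  of \<open>m\<close>. Numerators are controlled by |x q^m| <= |x|, denominators by
  \<open>qpoch_shift_lower_bound\<close>.\<close>

lemma well_poised_factor_bound:
  assumes q: "norm q < 1" and nz: "\<And>j. A * x * q ^ (j + 1) \<noteq> 1"
  obtains C where "C > 0"
    "\<And>m n. norm (well_poised_factor q A (x * q ^ m) n) \<le> C * (\<Prod>j<n. norm x + norm q ^ j)"
proof -
  have "A * x * q * q ^ j \<noteq> 1" for j using nz[of j] by (simp add: mult.assoc)
  then obtain \<delta> where \<delta>: "\<delta> > 0" "\<And>m n. norm (qpoch (A * x * q * q ^ m) q n) \<ge> \<delta>"
    using qpoch_shift_lower_bound[OF q] by metis
  have "norm (well_poised_factor q A (x * q ^ m) n) \<le> 1 / \<delta> * (\<Prod>j<n. norm x + norm q ^ j)" for m n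
  proof -
    have "norm (\<Prod>j<n. x * q ^ m - q ^ j) \<le> (\<Prod>j<n. norm x + norm q ^ j)"
      unfolding prod_norm[symmetric]
    proof (intro prod_mono conjI norm_ge_zero)
      fix j
      have "norm (x * q ^ m - q ^ j) \<le> norm x * norm q ^ m + norm q ^ j"
        by (metis norm_triangle_ineq4 norm_mult norm_power)
      also have "norm x * norm q ^ m \<le> norm x"
        using q by (simp add: mult_left_le power_le_one)
      finally show "norm (x * q ^ m - q ^ j) \<le> norm x + norm q ^ j" by simp
    qed
    then have "norm (\<Prod>j<n. x * q ^ m - q ^ j) / norm (qpoch (A * x * q * q ^ m) q n)
        \<le> (\<Prod>j<n. norm x + norm q ^ j) / \<delta>"
      using \<delta> by (intro frac_le) (auto intro!: prod_nonneg)
    then show ?thesis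
      by (simp add: well_poised_factor_eq norm_divide mult_ac)
  qed
  then show thesis using that[of "1 / \<delta>"] \<delta>(1) by simp
qed

text \<open>The powers of \<open>p\<close> die out, so the ratio of consecutive terms tends to
  \<open>c * (r * s * t * u)\<close>.\<close>

lemma summable_majorant:
  fixes c r s t u p :: real
  assumes "0 < p" "p < 1" "0 \<le> c" "0 \<le> r" "0 \<le> s" "0 \<le> t" "0 \<le> u" "c * (r * s * t * u) < 1"
  shows "summable (\<lambda>n. c ^ n * (\<Prod>j<n. (r + p ^ j) * (s + p ^ j) * (t + p ^ j) * (u + p ^ j)))"
    (is "summable ?f")
proof -
  let ?\<rho> = "\<lambda>n. c * ((r + p ^ n) * (s + p ^ n) * (t + p ^ n) * (u + p ^ n))"
  have "?\<rho> \<longlonglongrightarrow> c * ((r + 0) * (s + 0) * (t + 0) * (u + 0))"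
    using assms by (intro tendsto_intros LIMSEQ_power_zero) auto
  then have lim: "?\<rho> \<longlonglongrightarrow> c * (r * s * t * u)" by simp
  obtain k where k: "c * (r * s * t * u) < k" "k < 1" using assms dense by blast
  obtain N where N: "\<And>n. n \<ge> N \<Longrightarrow> ?\<rho> n < k"
    using order_tendstoD(2)[OF lim k(1)] unfolding eventually_sequentially by blast
  show ?thesis
  proof (rule summable_ratio_test[OF k(2)])
    fix n assume "n \<ge> N"
    have nn: "?f m \<ge> 0" for m using assms by (intro mult_nonneg_nonneg prod_nonneg) auto
    have "?f (Suc n) = ?\<rho> n * ?f n" by simp
    also have "\<dots> \<le> k * ?f n" using N[OF \<open>n \<ge> N\<close>] nn[of n] by (intro mult_right_mono) auto
    finally show "norm (?f (Suc n)) \<le> k * norm (?f n)"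
      using nn[of n] nn[of "Suc n"] by simp
  qed
qed

lemma vwp_weight_bound:
  assumes q: "norm q < 1"
    and nz: "\<And>w j. w \<in> {x, y, z, v} \<Longrightarrow> A * w * q ^ (j + 1) \<noteq> 1"
  obtains C where "C > 0"
    "\<And>m n. norm (vwp_weight q A (x * q ^ m) y z v n) \<le>
       C * (norm (q * A ^ 2) ^ n * (\<Prod>j<n. (norm x + norm q ^ j) * (norm y + norm q ^ j)
         * (norm z + norm q ^ j) * (norm v + norm q ^ j)))"
proof -
  let ?p = "\<lambda>w n. \<Prod>j<n. norm w + norm q ^ j"
  have ex: "\<exists>C>0. \<forall>m n. norm (well_poised_factor q A (w * q ^ m) n) \<le> C * ?p w n"
    if "w \<in> {x, y, z, v}" for w
    using well_poised_factor_bound[OF q nz[OF that]] by metis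
  obtain C1 where C1: "C1 > 0" "\<And>m n. norm (well_poised_factor q A (x * q ^ m) n) \<le> C1 * ?p x n"
    using ex[of x] by auto
  have ex0: "\<exists>C>0. \<forall>n. norm (well_poised_factor q A w n) \<le> C * ?p w n"
    if "w \<in> {x, y, z, v}" for w
    using ex[OF that] by (metis power_0 mult_1_right)
  obtain C2 where C2: "C2 > 0" "\<And>n. norm (well_poised_factor q A y n) \<le> C2 * ?p y n"
    using ex0[of y] by auto
  obtain C3 where C3: "C3 > 0" "\<And>n. norm (well_poised_factor q A z n) \<le> C3 * ?p z n"
    using ex0[of z] by auto
  obtain C4 where C4: "C4 > 0" "\<And>n. norm (well_poised_factor q A v n) \<le> C4 * ?p v n"
    using ex0[of v] by auto
  have pp: "?p w n \<ge> 0" for w n by (intro prod_nonneg) auto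
  have "norm (vwp_weight q A (x * q ^ m) y z v n)
      \<le> norm (q * A ^ 2) ^ n * (C1 * ?p x n) * (C2 * ?p y n) * (C3 * ?p z n) * (C4 * ?p v n)" for m n
    unfolding vwp_weight_def norm_mult[of "_ * _"] norm_mult[of "(q * A\<^sup>2) ^ n"] norm_power
    using C1 C2 C3 C4 pp
    by (intro mult_mono mult_nonneg_nonneg order_refl) (auto simp: less_imp_le norm_mult norm_power)
  moreover have "norm (q * A ^ 2) ^ n * (C1 * ?p x n) * (C2 * ?p y n) * (C3 * ?p z n) * (C4 * ?p v n)
     = C1 * C2 * C3 * C4 * (norm (q * A ^ 2) ^ n * (\<Prod>j<n. (norm x + norm q ^ j) * (norm y + norm q ^ j)
         * (norm z + norm q ^ j) * (norm v + norm q ^ j)))" for n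
    by (simp add: prod.distrib)
  ultimately show thesis using that[of "C1 * C2 * C3 * C4"] C1 C2 C3 C4 by simp
qed

lemma vwp_weight_swap:
  "vwp_weight q A x y z v = vwp_weight q A y x z v"
  "vwp_weight q A x y z v = vwp_weight q A z y x v"
  "vwp_weight q A x y z v = vwp_weight q A v y z x"
  by (auto simp: vwp_weight_def fun_eq_iff)

text \<open>The contiguous relation shifts the first parameter only; these transpositions bring any
  other parameter into that place.\<close>

lemma bilateral_vwp_swap:
  "bilateral_vwp q A x y z v = bilateral_vwp q A y x z v"
  "bilateral_vwp q A x y z v = bilateral_vwp q A z y x v"
  "bilateral_vwp q A x y z v = bilateral_vwp q A v y z x"
  unfolding bilateral_vwp_def vwp_sum_def
  by (subst (1 2) vwp_weight_swap(1), simp add: mult_ac)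
     (subst (1 2) vwp_weight_swap(2), simp add: mult_ac,
      subst (1 2) vwp_weight_swap(3), simp add: mult_ac)

subsection \<open>The contiguous relation\<close>

text \<open>With \<open>s\<close> = q^n this is the termwise relation multiplied by \<open>s\<close>
  and divided by the weight at \<open>x * q\<close>. On the left stand the terms for
  \<open>x\<close> and \<open>x * q\<close>, on the right the certificate at n + 1 and at n.\<close>

lemma gosper_identity:
  fixes A q s x y z v :: complex
  shows "(1 - q * A ^ 2 * x * y * z * v) * (1 - A * s ^ 2) * (s - q * x) * (1 - A * q * x * s)
     - (1 - A * q * x * y) * (1 - A * q * x * z) * (1 - A * q * x * v) * s * (1 - A * s ^ 2)
   = x * q * A ^ 2 * (q * x - s) * (y - s) * (z - s) * (v - s)
     - x * q * (1 - A * q * x * s) * (1 - A * y * s) * (1 - A * z * s) * (1 - A * v * s)"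
  by algebra

lemma well_poised_factor_0 [simp]: "well_poised_factor q A x 0 = 1"
  by (simp add: well_poised_factor_def)

lemma well_poised_factor_Suc:
  "well_poised_factor q A x (Suc n) =
     well_poised_factor q A x n * ((x - q ^ n) / (1 - A * x * q ^ (n + 1)))"
  by (simp add: well_poised_factor_def)

text \<open>Since xq - q^(j+1) = q (x - q^j), the products for \<open>x\<close> and
  \<open>x * q\<close> share all but their end factors and a power of \<open>q\<close>. The form
  without division also covers \<open>q * x = 1\<close>.\<close>

lemma well_poised_factor_contiguous:
  assumes nz: "\<And>j. A * x * q ^ (j + 1) \<noteq> 1"
  shows "(1 - q * x) * (1 - A * x * q) * q ^ n * well_poised_factor q A x n =
     (q ^ n - q * x) * (1 - A * x * q ^ (n + 1)) * well_poised_factor q A (x * q) n"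
proof (induction n)
  case (Suc n)
  have nz1: "1 - A * x * q ^ (n + 1) \<noteq> 0" and nz2: "1 - A * (x * q) * q ^ (n + 1) \<noteq> 0"
    using nz[of n] nz[of "Suc n"] by (auto simp: mult_ac dest: sym)
  have "(1 - q * x) * (1 - A * x * q) * q ^ Suc n * well_poised_factor q A x (Suc n)
      = ((1 - q * x) * (1 - A * x * q) * q ^ n * well_poised_factor q A x n)
         * (q * (x - q ^ n) / (1 - A * x * q ^ (n + 1)))"
    by (simp add: well_poised_factor_Suc)
  also have "\<dots> = q * (x - q ^ n) * (q ^ n - q * x) * well_poised_factor q A (x * q) n"
    unfolding Suc using nz1 by (simp add: divide_simps)
  also have "\<dots> = (q ^ Suc n - q * x) * (1 - A * x * q ^ (Suc n + 1)) * well_poised_factor q A (x * q) (Suc n)"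
    unfolding well_poised_factor_Suc using nz2 by (simp add: divide_simps) (simp add: algebra_simps)
  finally show ?case .
qed simp

text \<open>
  The certificate \<open>G\<^sub>n\<close> whose differences are the contiguous relation termwise: after the common factors are
  removed, both sides are polynomials of degree 4 in \<open>q\<^sup>n\<close>, and comparing them gives \<open>gosper_identity\<close>.
\<close>
definition gosper_cert ::
  "complex \<Rightarrow> complex \<Rightarrow> complex \<Rightarrow> complex \<Rightarrow> complex \<Rightarrow> complex \<Rightarrow> nat \<Rightarrow> complex" where
  "gosper_cert q A x y z v n =
     x * q / q ^ n * ((1 - A * q * x * q ^ n) * (1 - A * y * q ^ n) * (1 - A * z * q ^ n)
       * (1 - A * v * q ^ n)) * vwp_weight q A (x * q) y z v n"

lemma vwp_term_telescopes:
  assumes q0: "q \<noteq> 0"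
    and nz: "\<And>w j. w \<in> {x, y, z, v} \<Longrightarrow> A * w * q ^ (j + 1) \<noteq> 1"
  shows "(1 - A * q * x) * (1 - q * x) * (1 - q * A ^ 2 * x * y * z * v)
        * ((1 - A * q ^ (2 * n)) * vwp_weight q A x y z v n)
      - (1 - A * q * x * y) * (1 - A * q * x * z) * (1 - A * q * x * v)
        * ((1 - A * q ^ (2 * n)) * vwp_weight q A (x * q) y z v n)
      = gosper_cert q A x y z v (Suc n) - gosper_cert q A x y z v n"
proof -
  define s where "s = q ^ n"
  define U where "U = vwp_weight q A (x * q) y z v n"
  define w where "w = 1 - q * A ^ 2 * x * y * z * v"
  define \<beta> where "\<beta> = (1 - A * q * x * y) * (1 - A * q * x * z) * (1 - A * q * x * v)"
  have s0: "s \<noteq> 0" and q2: "q ^ (2 * n) = s ^ 2"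
    using q0 by (auto simp: s_def power_mult[symmetric] mult.commute)
  have d: "1 - A * y * q ^ (n + 1) \<noteq> 0" "1 - A * z * q ^ (n + 1) \<noteq> 0"
      "1 - A * v * q ^ (n + 1) \<noteq> 0" "1 - A * (x * q) * q ^ (n + 1) \<noteq> 0"
    using nz[of y n] nz[of z n] nz[of v n] nz[of x "Suc n"] by (auto simp: mult_ac dest: sym)
  have "(1 - A * q * x) * (1 - q * x) * s * vwp_weight q A x y z v n
      = ((1 - q * x) * (1 - A * x * q) * q ^ n * well_poised_factor q A x n) * ((q * A ^ 2) ^ n
        * well_poised_factor q A y n * well_poised_factor q A z n * well_poised_factor q A v n)"
    by (simp add: vwp_weight_def s_def)
  also have "\<dots> = (s - q * x) * (1 - A * q * x * s) * U"
    using nz[of x] by (subst well_poised_factor_contiguous) (simp_all add: vwp_weight_def s_def U_def)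
  finally have e1: "(1 - A * q * x) * (1 - q * x) * s * vwp_weight q A x y z v n
      = (s - q * x) * (1 - A * q * x * s) * U" .
  \<comment> \<open>The four linear factors of the certificate at n + 1 are exactly the new
    denominators of the weight, and cancel them.\<close>
  have "gosper_cert q A x y z v (Suc n)
      = x * q / (q * s) * ((1 - A * (x * q) * q ^ (n + 1)) * (1 - A * y * q ^ (n + 1)) * (1 - A * z * q ^ (n + 1))
       * (1 - A * v * q ^ (n + 1))) * (q * A ^ 2 * U *
         ((x * q - s) / (1 - A * (x * q) * q ^ (n + 1)) * ((y - s) / (1 - A * y * q ^ (n + 1)))
          * ((z - s) / (1 - A * z * q ^ (n + 1))) * ((v - s) / (1 - A * v * q ^ (n + 1)))))"
    unfolding gosper_cert_def vwp_weight_def U_def well_poised_factor_Suc s_def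
    by (simp add: mult_ac)
  also have "\<dots> = x / s * (q * A ^ 2 * U * (x * q - s) * (y - s) * (z - s) * (v - s))"
    using d q0 s0 by (simp add: divide_simps)
  finally have e2: "s * gosper_cert q A x y z v (Suc n)
      = x * q * A ^ 2 * (q * x - s) * (y - s) * (z - s) * (v - s) * U"
    using s0 by (simp add: mult_ac)
  have e3: "s * gosper_cert q A x y z v n
      = x * q * (1 - A * q * x * s) * (1 - A * y * s) * (1 - A * z * s) * (1 - A * v * s) * U"
    using s0 by (simp add: gosper_cert_def s_def U_def)
  \<comment> \<open>The multiplier \<open>s\<close> makes \<open>e1\<close>, \<open>e2\<close> and
    \<open>e3\<close> applicable, so that every term becomes a polynomial times
    \<open>U\<close>.\<close>
  have "s * ((1 - A * q * x) * (1 - q * x) * w * ((1 - A * s ^ 2) * vwp_weight q A x y z v n)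
      - \<beta> * ((1 - A * s ^ 2) * U))
    = w * (1 - A * s ^ 2) * ((1 - A * q * x) * (1 - q * x) * s * vwp_weight q A x y z v n)
      - \<beta> * s * (1 - A * s ^ 2) * U"
    by (simp only: right_diff_distrib[of s] mult_ac)
  also have "\<dots> = (w * (1 - A * s ^ 2) * (s - q * x) * (1 - A * q * x * s) - \<beta> * s * (1 - A * s ^ 2)) * U"
    unfolding e1 left_diff_distrib[of _ _ U] by (simp only: mult_ac)
  also have "\<dots> = s * (gosper_cert q A x y z v (Suc n) - gosper_cert q A x y z v n)"
    unfolding w_def \<beta>_def gosper_identity right_diff_distrib[of s] e2 e3 left_diff_distrib[of _ _ U] ..
  finally show ?thesis
    using s0 unfolding w_def \<beta>_def U_def q2 by simp
qed

section \<open>Convergence and summation of the telescoping identity\<close>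

lemma nonvanishing_shift:
  fixes A x q :: complex
  assumes "\<And>j. A * x * q ^ (j + 1) \<noteq> 1"
  shows "A * (x * q) * q ^ (j + 1) \<noteq> 1"
  using assms[of "j + 1"] by (simp add: mult_ac)

lemma vwp_term_majorant:
  assumes q: "0 < norm q" "norm q < 1"
    and nz: "\<And>w j. w \<in> {x, y, z, v} \<Longrightarrow> A * w * q ^ (j + 1) \<noteq> 1"
    and conv: "norm (q * A ^ 2 * x * y * z * v) < 1"
  obtains M where "summable M"
    "\<And>m n. norm ((1 - A * q ^ (2 * n)) * vwp_weight q A (x * q ^ m) y z v n) \<le> M n"
proof -
  let ?M = "\<lambda>n. norm (q * A ^ 2) ^ n * (\<Prod>j<n. (norm x + norm q ^ j) * (norm y + norm q ^ j)
         * (norm z + norm q ^ j) * (norm v + norm q ^ j))"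
  obtain C where C: "C > 0" "\<And>m n. norm (vwp_weight q A (x * q ^ m) y z v n) \<le> C * ?M n"
    by (rule vwp_weight_bound[of q x y z v A, OF q(2)]) (use nz in blast)+
  have "summable (\<lambda>n. (1 + norm A) * (C * ?M n))"
    using q conv by (intro summable_mult summable_majorant) (auto simp: norm_mult mult_ac)
  moreover have "norm ((1 - A * q ^ (2 * n)) * vwp_weight q A (x * q ^ m) y z v n)
      \<le> (1 + norm A) * (C * ?M n)" for m n
  proof -
    have "norm (1 - A * q ^ (2 * n)) \<le> 1 + norm A * norm q ^ (2 * n)"
      by (metis norm_triangle_ineq4 norm_mult norm_power norm_one)
    also have "\<dots> \<le> 1 + norm A" using q by (simp add: mult_left_le power_le_one)
    finally show ?thesis
      unfolding norm_mult[of "1 - _"] using C(2)[of m n] by (intro mult_mono) auto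
  qed
  ultimately show thesis by (rule that)
qed

lemma summable_vwp:
  assumes q: "0 < norm q" "norm q < 1"
    and nz: "\<And>w j. w \<in> {x, y, z, v} \<Longrightarrow> A * w * q ^ (j + 1) \<noteq> 1"
    and conv: "norm (q * A ^ 2 * x * y * z * v) < 1"
  shows "summable (\<lambda>n. (1 - A * q ^ (2 * n)) * vwp_weight q A x y z v n)"
proof -
  obtain M where M: "summable M"
    "\<And>m n. norm ((1 - A * q ^ (2 * n)) * vwp_weight q A (x * q ^ m) y z v n) \<le> M n"
    by (rule vwp_term_majorant[of q x y z v A, OF q _ conv], rule nz, assumption, rule that)
  show ?thesis
    using M(1) by (rule summable_comparison_test') (use M(2)[of _ 0] in simp)
qed

lemma tendsto_vwp_sum:
  assumes q: "0 < norm q" "norm q < 1"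
    and nz: "\<And>w j. w \<in> {x, y, z, v} \<Longrightarrow> A * w * q ^ (j + 1) \<noteq> 1"
    and conv: "norm (q * A ^ 2 * x * y * z * v) < 1"
  shows "(\<lambda>m. vwp_sum q A (x * q ^ m) y z v) \<longlonglongrightarrow> vwp_sum q A 0 y z v"
proof -
  obtain M where M: "summable M"
    "\<And>m n. norm ((1 - A * q ^ (2 * n)) * vwp_weight q A (x * q ^ m) y z v n) \<le> M n"
    by (rule vwp_term_majorant[of q x y z v A, OF q _ conv], rule nz, assumption, rule that)
  have xq: "(\<lambda>m. x * q ^ m) \<longlonglongrightarrow> 0"
    using tendsto_mult_right_zero[OF LIMSEQ_power_zero[OF q(2)]] .
  have "(\<lambda>m. well_poised_factor q A (x * q ^ m) n) \<longlonglongrightarrow> well_poised_factor q A 0 n" for n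
    unfolding well_poised_factor_def by (intro tendsto_intros xq) simp
  then have lim: "(\<lambda>m. (1 - A * q ^ (2 * n)) * vwp_weight q A (x * q ^ m) y z v n)
      \<longlonglongrightarrow> (1 - A * q ^ (2 * n)) * vwp_weight q A 0 y z v n" for n
    unfolding vwp_weight_def by (intro tendsto_intros)
  show ?thesis
    unfolding vwp_sum_def
    by (rule tannerys_theorem[where F = sequentially and M = M
      and a = "\<lambda>n m. (1 - A * q ^ (2 * n)) * vwp_weight q A (x * q ^ m) y z v n"
      and b = "\<lambda>n. (1 - A * q ^ (2 * n)) * vwp_weight q A 0 y z v n",
      THEN conjunct2, THEN conjunct2, OF lim _ M(1)])
      (auto intro!: always_eventually M(2))
qed

text \<open>Dividing the weight at \<open>x * q\<close> by q^n changes the limiting ratio from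
  qA^2(xq)yzv to A^2(xq)yzv. This is the argument belonging to \<open>x\<close> itself, so
  \<open>conv\<close> still gives summability, and the terms tend to 0.\<close>

lemma gosper_cert_tendsto_0:
  assumes q: "0 < norm q" "norm q < 1"
    and nz: "\<And>w j. w \<in> {x, y, z, v} \<Longrightarrow> A * w * q ^ (j + 1) \<noteq> 1"
    and conv: "norm (q * A ^ 2 * x * y * z * v) < 1"
  shows "gosper_cert q A x y z v \<longlonglongrightarrow> 0"
proof -
  let ?P = "\<lambda>n. (\<Prod>j<n. (norm (x * q) + norm q ^ j) * (norm y + norm q ^ j)
         * (norm z + norm q ^ j) * (norm v + norm q ^ j))"
  have nz': "A * w * q ^ (j + 1) \<noteq> 1" if "w \<in> {x * q, y, z, v}" for w j
    using that nz nonvanishing_shift[OF nz[of x]] by blast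
  obtain C where C: "C > 0"
    "\<And>m n. norm (vwp_weight q A (x * q * q ^ m) y z v n) \<le> C * (norm (q * A ^ 2) ^ n * ?P n)"
    by (rule vwp_weight_bound[of q "x * q" y z v A, OF q(2)]) (use nz' in blast)+
  have "summable (\<lambda>n. C * (norm (A ^ 2) ^ n * ?P n))"
    using q conv by (intro summable_mult summable_majorant) (auto simp: norm_mult mult_ac)
  moreover have "norm (vwp_weight q A (x * q) y z v n / q ^ n) \<le> C * (norm (A ^ 2) ^ n * ?P n)" for n
    using C(2)[of 0 n] q by (simp add: norm_divide norm_power norm_mult power_mult_distrib field_simps)
  ultimately have "summable (\<lambda>n. vwp_weight q A (x * q) y z v n / q ^ n)"
    by (rule summable_comparison_test')
  then have lim: "(\<lambda>n. vwp_weight q A (x * q) y z v n / q ^ n) \<longlonglongrightarrow> 0"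
    by (rule summable_LIMSEQ_zero)
  have "(\<lambda>n. x * q * ((1 - A * q * x * q ^ n) * (1 - A * y * q ^ n) * (1 - A * z * q ^ n)
       * (1 - A * v * q ^ n)) * (vwp_weight q A (x * q) y z v n / q ^ n))
     \<longlonglongrightarrow> x * q * ((1 - A * q * x * 0) * (1 - A * y * 0) * (1 - A * z * 0) * (1 - A * v * 0)) * 0"
    by (intro tendsto_intros lim LIMSEQ_power_zero q)
  then show ?thesis
    unfolding gosper_cert_def by (simp add: mult_ac)
qed

text \<open>The certificate vanishes at infinity but not at index 0; its value there is the
  inhomogeneous term of this one-sided relation.\<close>

lemma vwp_sum_contiguous:
  assumes q: "0 < norm q" "norm q < 1"
    and nz: "\<And>w j. w \<in> {x, y, z, v} \<Longrightarrow> A * w * q ^ (j + 1) \<noteq> 1"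
    and conv: "norm (q * A ^ 2 * x * y * z * v) < 1"
  shows "(1 - A * q * x) * (1 - q * x) * (1 - q * A ^ 2 * x * y * z * v) * vwp_sum q A x y z v
      = (1 - A * q * x * y) * (1 - A * q * x * z) * (1 - A * q * x * v) * vwp_sum q A (x * q) y z v
        - x * q * ((1 - A * q * x) * (1 - A * y) * (1 - A * z) * (1 - A * v))"
proof -
  have q0: "q \<noteq> 0" using q by auto
  have nz': "A * w * q ^ (j + 1) \<noteq> 1" if "w \<in> {x * q, y, z, v}" for w j
    using that nz nonvanishing_shift[OF nz[of x]] by blast
  have "norm (q * A ^ 2 * (x * q) * y * z * v) = norm (q * A ^ 2 * x * y * z * v) * norm q"
    by (simp add: norm_mult)
  also have "\<dots> < 1"
    using conv q(2) by (meson le_less_trans mult_left_le norm_ge_zero less_imp_le)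
  finally have conv': "norm (q * A ^ 2 * (x * q) * y * z * v) < 1" .
  let ?\<alpha> = "(1 - A * q * x) * (1 - q * x) * (1 - q * A ^ 2 * x * y * z * v)"
  let ?\<beta> = "(1 - A * q * x * y) * (1 - A * q * x * z) * (1 - A * q * x * v)"
  have tel: "?\<alpha> * ((1 - A * q ^ (2 * n)) * vwp_weight q A x y z v n)
      - ?\<beta> * ((1 - A * q ^ (2 * n)) * vwp_weight q A (x * q) y z v n)
      = gosper_cert q A x y z v (Suc n) - gosper_cert q A x y z v n" for n
    by (rule vwp_term_telescopes[OF q0]) (rule nz)
  have "(\<lambda>n. ?\<alpha> * ((1 - A * q ^ (2 * n)) * vwp_weight q A x y z v n)
      - ?\<beta> * ((1 - A * q ^ (2 * n)) * vwp_weight q A (x * q) y z v n))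
     sums (?\<alpha> * vwp_sum q A x y z v - ?\<beta> * vwp_sum q A (x * q) y z v)"
    unfolding vwp_sum_def
    by (intro sums_diff sums_mult summable_sums summable_vwp q conv conv' nz nz')
  moreover have "(\<lambda>n. ?\<alpha> * ((1 - A * q ^ (2 * n)) * vwp_weight q A x y z v n)
      - ?\<beta> * ((1 - A * q ^ (2 * n)) * vwp_weight q A (x * q) y z v n))
     sums (0 - gosper_cert q A x y z v 0)"
    unfolding tel
    by (intro telescope_sums gosper_cert_tendsto_0 q conv nz)
  ultimately have "?\<alpha> * vwp_sum q A x y z v - ?\<beta> * vwp_sum q A (x * q) y z v
     = 0 - gosper_cert q A x y z v 0"
    by (rule sums_unique2)
  then have "?\<alpha> * vwp_sum q A x y z v = ?\<beta> * vwp_sum q A (x * q) y z v - gosper_cert q A x y z v 0"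
    unfolding diff_eq_eq by (simp only: diff_0 uminus_add_conv_diff)
  also have "gosper_cert q A x y z v 0 = x * q * ((1 - A * q * x) * (1 - A * y) * (1 - A * z) * (1 - A * v))"
    by (simp add: gosper_cert_def vwp_weight_def)
  finally show ?thesis .
qed

section \<open>The bilateral relation and the elimination of parameters\<close>

lemma swapped_nonvanishing:
  fixes A q w :: complex
  assumes "q \<noteq> 0" "A \<noteq> 0" "w * q ^ (j + 2) \<noteq> 1"
  shows "q ^ 2 / A * (w * A / q) * q ^ (j + 1) \<noteq> 1"
proof -
  have "q ^ 2 / A * (w * A / q) * q ^ (j + 1) = w * q ^ (j + 2)"
    using assms(1,2) by (simp add: power2_eq_square)
  then show ?thesis using assms(3) by metis
qed

text \<open>Reflecting the index, n to -1 - n, replaces \<open>A\<close> by q^2/A and each parameter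
  w by wA/q. The argument of the series is invariant, so both halves converge under the same
  condition.\<close>

lemma swapped_argument:
  fixes A q x y z v :: complex
  assumes "q \<noteq> 0" "A \<noteq> 0"
  shows "q * (q ^ 2 / A) ^ 2 * (x * A / q) * (y * A / q) * (z * A / q) * (v * A / q)
     = q * A ^ 2 * x * y * z * v"
  using assms by (simp add: field_simps power2_eq_square)

text \<open>\<open>vwp_sum_contiguous\<close> holds for both halves with the same \<open>w\<close>
  and \<open>\<beta>\<close>, since these are invariant under reflection, while 1 - Aqx and 1 - q^2
  x change places, as do 1 - qx and 1 - Ax. In the combination the boundary terms cancel.\<close>

lemma bilateral_vwp_contiguous:
  assumes q: "0 < norm q" "norm q < 1" and A: "A \<noteq> 0"
    and nz: "\<And>w j. w \<in> {x, y, z, v} \<Longrightarrow> A * w * q ^ (j + 1) \<noteq> 1"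
    and nz': "\<And>w j. w \<in> {x, y, z, v} \<Longrightarrow> w * q ^ (j + 2) \<noteq> 1"
    and conv: "norm (q * A ^ 2 * x * y * z * v) < 1"
  shows "(1 - A * q * x) * (1 - q ^ 2 * x) * (1 - q * A ^ 2 * x * y * z * v) * bilateral_vwp q A x y z v
     = (1 - A * q * x * y) * (1 - A * q * x * z) * (1 - A * q * x * v) * bilateral_vwp q A (x * q) y z v"
proof -
  have q0: "q \<noteq> 0" using q by auto
  define w where "w = 1 - q * A ^ 2 * x * y * z * v"
  define \<beta> where "\<beta> = (1 - A * q * x * y) * (1 - A * q * x * z) * (1 - A * q * x * v)"
  define Ya where "Ya = (1 - A * y) * (1 - A * z) * (1 - A * v)"
  define Yq where "Yq = (1 - q * y) * (1 - q * z) * (1 - q * v)"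
  define S where "S = vwp_sum q A x y z v"
  define S1 where "S1 = vwp_sum q A (x * q) y z v"
  define T where "T = vwp_sum q (q ^ 2 / A) (x * A / q) (y * A / q) (z * A / q) (v * A / q)"
  define T1 where "T1 = vwp_sum q (q ^ 2 / A) (x * q * A / q) (y * A / q) (z * A / q) (v * A / q)"
  define p where "p = 1 - A * q * x"
  define r where "r = 1 - q ^ 2 * x"
  have "p * (1 - q * x) * w * S = \<beta> * S1 - x * q * (p * (1 - A * y) * (1 - A * z) * (1 - A * v))"
    unfolding w_def \<beta>_def S_def S1_def p_def
    by (rule vwp_sum_contiguous[OF q _ conv]) (rule nz)
  then have E1: "p * (1 - q * x) * w * S = \<beta> * S1 - x * q * p * Ya"
    by (simp add: Ya_def mult_ac)
  have nz2: "q ^ 2 / A * u * q ^ (j + 1) \<noteq> 1"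
    if "u \<in> {x * A / q, y * A / q, z * A / q, v * A / q}" for u j
    using that swapped_nonvanishing[OF q0 A nz'] by blast
  have simps: "q ^ 2 / A * q * (x * A / q) = q ^ 2 * x" "q * (x * A / q) = A * x"
      "q ^ 2 / A * q * (x * A / q) * (y * A / q) = A * q * x * y"
      "q ^ 2 / A * q * (x * A / q) * (z * A / q) = A * q * x * z"
      "q ^ 2 / A * q * (x * A / q) * (v * A / q) = A * q * x * v"
      "x * A / q * q = x * q * A / q" "x * q * A / q * q = x * q * A"
      "q ^ 2 / A * (y * A / q) = q * y" "q ^ 2 / A * (z * A / q) = q * z"  "q ^ 2 / A * (v * A / q) = q * v"
    using A q0 by (simp_all add: field_simps power2_eq_square)
  have "r * (1 - A * x) * w * T = \<beta> * T1 - x * A / q * q * (r * (1 - q * y) * (1 - q * z) * (1 - q * v))"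
    using vwp_sum_contiguous[OF q, of "x * A / q" "y * A / q" "z * A / q" "v * A / q" "q ^ 2 / A", OF nz2]
      conv
    unfolding swapped_argument[OF q0 A] simps(3-5)
    unfolding simps(1,2,8-10) w_def[symmetric] \<beta>_def[symmetric] T_def[symmetric] r_def[symmetric]
    unfolding simps(6) T1_def[symmetric]
    by auto
  then have E2: "r * (1 - A * x) * w * T = \<beta> * T1 - x * A * r * Yq"
    using q0 by (simp add: Yq_def mult_ac)
  have gA: "q / A * A = q" using A by simp
  have "p * r * w * ((1 - q * x) * Yq * S - q / A * ((1 - A * x) * Ya * T))
      = r * Yq * (p * (1 - q * x) * w * S) - q / A * p * Ya * (r * (1 - A * x) * w * T)"
    unfolding right_diff_distrib[of "p * r * w"] by (simp only: mult_ac)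
  \<comment> \<open>Both boundary terms are multiples of \<open>x * p * r * Ya * Yq\<close>; the
    weight \<open>q / A\<close> of the second half makes their coefficients equal.\<close>
  also have "\<dots> = r * Yq * (\<beta> * S1) - q / A * p * Ya * (\<beta> * T1) - (q - q / A * A) * (x * p * r * Ya * Yq)"
    unfolding E1 E2 by (simp only: right_diff_distrib left_diff_distrib mult_ac) simp
  also have "\<dots> = \<beta> * (r * Yq * S1 - q / A * (p * Ya * T1))"
    unfolding gA by (simp add: right_diff_distrib[of \<beta>] mult_ac)
  finally have main: "p * r * w * ((1 - q * x) * Yq * S - q / A * ((1 - A * x) * Ya * T))
      = \<beta> * (r * Yq * S1 - q / A * (p * Ya * T1))" .
  have "bilateral_vwp q A x y z v = (1 - q * x) * Yq * S - q / A * ((1 - A * x) * Ya * T)"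
    by (simp add: bilateral_vwp_def Yq_def Ya_def S_def T_def mult.assoc)
  moreover have "bilateral_vwp q A (x * q) y z v = r * Yq * S1 - q / A * (p * Ya * T1)"
    by (simp add: bilateral_vwp_def Yq_def Ya_def S1_def T1_def r_def p_def mult_ac power2_eq_square)
  ultimately show ?thesis
    using main unfolding p_def r_def w_def \<beta>_def by simp
qed

lemma bilateral_vwp_iterate:
  assumes q: "0 < norm q" "norm q < 1" and A: "A \<noteq> 0"
    and nz: "\<And>w j. w \<in> {x, y, z, v} \<Longrightarrow> A * w * q ^ (j + 1) \<noteq> 1"
    and nz': "\<And>w j. w \<in> {x, y, z, v} \<Longrightarrow> w * q ^ (j + 2) \<noteq> 1"
    and conv: "norm (q * A ^ 2 * x * y * z * v) < 1"
  shows "qpoch (A * q * x) q m * qpoch (q ^ 2 * x) q m * qpoch (q * A ^ 2 * x * y * z * v) q m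
       * bilateral_vwp q A x y z v
     = qpoch (A * q * x * y) q m * qpoch (A * q * x * z) q m * qpoch (A * q * x * v) q m
       * bilateral_vwp q A (x * q ^ m) y z v"
proof (induction m)
  case 0
  show ?case by (simp add: qpoch_def)
next
  case (Suc m)
  have n1: "A * w * q ^ (j + 1) \<noteq> 1" if "w \<in> {x * q ^ m, y, z, v}" for w j
  proof (cases "w = x * q ^ m")
    case True
    then show ?thesis using nz[of x "m + j"] by (simp add: power_add mult_ac)
  qed (use that nz[of w j] in auto)
  have n2: "w * q ^ (j + 2) \<noteq> 1" if "w \<in> {x * q ^ m, y, z, v}" for w j
  proof (cases "w = x * q ^ m")
    case True
    then show ?thesis using nz'[of x "m + j"] by (simp add: power_add mult_ac)
  qed (use that nz'[of w j] in auto)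
  have "norm (q * A ^ 2 * (x * q ^ m) * y * z * v) = norm (q * A ^ 2 * x * y * z * v) * norm q ^ m"
    by (simp add: norm_mult norm_power)
  also have "\<dots> \<le> norm (q * A ^ 2 * x * y * z * v)"
    using q by (intro mult_left_le power_le_one) auto
  finally have c: "norm (q * A ^ 2 * (x * q ^ m) * y * z * v) < 1" using conv by simp
  let ?l = "(1 - A * q * (x * q ^ m)) * (1 - q ^ 2 * (x * q ^ m)) * (1 - q * A ^ 2 * (x * q ^ m) * y * z * v)"
  let ?r = "(1 - A * q * (x * q ^ m) * y) * (1 - A * q * (x * q ^ m) * z) * (1 - A * q * (x * q ^ m) * v)"
  let ?L = "\<lambda>m. qpoch (A * q * x) q m * qpoch (q ^ 2 * x) q m * qpoch (q * A ^ 2 * x * y * z * v) q m"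
  let ?R = "\<lambda>m. qpoch (A * q * x * y) q m * qpoch (A * q * x * z) q m * qpoch (A * q * x * v) q m"
  have step: "?l * bilateral_vwp q A (x * q ^ m) y z v = ?r * bilateral_vwp q A (x * q ^ Suc m) y z v"
    using bilateral_vwp_contiguous[OF q A n1 n2 c] by (simp add: mult_ac)
  have "?L (Suc m) * bilateral_vwp q A x y z v = ?l * (?L m * bilateral_vwp q A x y z v)"
    by (simp add: qpoch_def mult_ac)
  also have "\<dots> = ?R m * (?l * bilateral_vwp q A (x * q ^ m) y z v)"
    unfolding Suc by (simp only: mult_ac)
  also have "\<dots> = ?R (Suc m) * bilateral_vwp q A (x * q ^ Suc m) y z v"
    unfolding step by (simp add: qpoch_def mult_ac)
  finally show ?case .
qed

text \<open>The limit of \<open>bilateral_vwp_iterate\<close> for m tending to infinity: the shifted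
  parameter tends to 0 and the finite products become infinite ones.\<close>

lemma bilateral_vwp_eliminate:
  assumes q: "0 < norm q" "norm q < 1" and A: "A \<noteq> 0"
    and nz: "\<And>w j. w \<in> {x, y, z, v} \<Longrightarrow> A * w * q ^ (j + 1) \<noteq> 1"
    and nz': "\<And>w j. w \<in> {x, y, z, v} \<Longrightarrow> w * q ^ (j + 2) \<noteq> 1"
    and conv: "norm (q * A ^ 2 * x * y * z * v) < 1"
  shows "qpoch_inf (A * q * x) q * qpoch_inf (q ^ 2 * x) q * qpoch_inf (q * A ^ 2 * x * y * z * v) q
       * bilateral_vwp q A x y z v
     = qpoch_inf (A * q * x * y) q * qpoch_inf (A * q * x * z) q * qpoch_inf (A * q * x * v) q
       * bilateral_vwp q A 0 y z v"
proof -
  have q0: "q \<noteq> 0" using q by auto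
  have xq: "(\<lambda>m. x * q ^ m) \<longlonglongrightarrow> 0"
    using tendsto_mult_right_zero[OF LIMSEQ_power_zero[OF q(2)]] .
  have nz2: "q ^ 2 / A * u * q ^ (j + 1) \<noteq> 1"
    if "u \<in> {x * A / q, y * A / q, z * A / q, v * A / q}" for u j
    using that swapped_nonvanishing[OF q0 A nz'] by blast
  have "(\<lambda>m. vwp_sum q (q ^ 2 / A) (x * A / q * q ^ m) (y * A / q) (z * A / q) (v * A / q))
      \<longlonglongrightarrow> vwp_sum q (q ^ 2 / A) 0 (y * A / q) (z * A / q) (v * A / q)"
    by (rule tendsto_vwp_sum[OF q nz2]) (use conv swapped_argument[OF q0 A] in auto)
  then have l2: "(\<lambda>m. vwp_sum q (q ^ 2 / A) (x * q ^ m * A / q) (y * A / q) (z * A / q) (v * A / q))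
      \<longlonglongrightarrow> vwp_sum q (q ^ 2 / A) (0 * A / q) (y * A / q) (z * A / q) (v * A / q)"
    by (simp add: mult_ac)
  have l1: "(\<lambda>m. vwp_sum q A (x * q ^ m) y z v) \<longlonglongrightarrow> vwp_sum q A 0 y z v"
    by (rule tendsto_vwp_sum[OF q nz conv])
  have "(\<lambda>m. bilateral_vwp q A (x * q ^ m) y z v) \<longlonglongrightarrow> bilateral_vwp q A 0 y z v"
    unfolding bilateral_vwp_def by (intro tendsto_intros xq l1 l2)
  then have R: "(\<lambda>m. qpoch (A * q * x * y) q m * qpoch (A * q * x * z) q m * qpoch (A * q * x * v) q m
       * bilateral_vwp q A (x * q ^ m) y z v) \<longlonglongrightarrow> qpoch_inf (A * q * x * y) q * qpoch_inf (A * q * x * z) q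
       * qpoch_inf (A * q * x * v) q * bilateral_vwp q A 0 y z v"
    by (intro tendsto_intros tendsto_qpoch q)
  have L: "(\<lambda>m. qpoch (A * q * x) q m * qpoch (q ^ 2 * x) q m * qpoch (q * A ^ 2 * x * y * z * v) q m
       * bilateral_vwp q A x y z v) \<longlonglongrightarrow> qpoch_inf (A * q * x) q * qpoch_inf (q ^ 2 * x) q
       * qpoch_inf (q * A ^ 2 * x * y * z * v) q * bilateral_vwp q A x y z v"
    by (intro tendsto_intros tendsto_qpoch q)
  have "qpoch (A * q * x) q m * qpoch (q ^ 2 * x) q m * qpoch (q * A ^ 2 * x * y * z * v) q m
       * bilateral_vwp q A x y z v
     = qpoch (A * q * x * y) q m * qpoch (A * q * x * z) q m * qpoch (A * q * x * v) q m
       * bilateral_vwp q A (x * q ^ m) y z v" for m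
    by (rule bilateral_vwp_iterate[OF q A nz nz' conv])
  with L R show ?thesis by (simp add: LIMSEQ_unique)
qed

text \<open>The parameters are eliminated in turn. Each pair contributes its product once, when its
  first member is eliminated. After the first elimination the argument of the series is 0 and its
  product is 1.\<close>

lemma bilateral_vwp_reduce:
  assumes q: "0 < norm q" "norm q < 1" and A: "A \<noteq> 0"
    and nz: "\<And>w j. w \<in> {x, y, z, v} \<Longrightarrow> A * w * q ^ (j + 1) \<noteq> 1"
    and nz': "\<And>w j. w \<in> {x, y, z, v} \<Longrightarrow> w * q ^ (j + 2) \<noteq> 1"
    and conv: "norm (q * A ^ 2 * x * y * z * v) < 1"
  shows "qpoch_inf (A * q * x) q * qpoch_inf (q ^ 2 * x) q * (qpoch_inf (A * q * y) q * qpoch_inf (q ^ 2 * y) q)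
       * (qpoch_inf (A * q * z) q * qpoch_inf (q ^ 2 * z) q) * (qpoch_inf (A * q * v) q * qpoch_inf (q ^ 2 * v) q)
       * qpoch_inf (q * A ^ 2 * x * y * z * v) q * bilateral_vwp q A x y z v
     = qpoch_inf (A * q * x * y) q * qpoch_inf (A * q * x * z) q * qpoch_inf (A * q * x * v) q
       * qpoch_inf (A * q * y * z) q * qpoch_inf (A * q * y * v) q * qpoch_inf (A * q * z * v) q
       * bilateral_vwp q A 0 0 0 0"
proof -
  let ?B = "bilateral_vwp q A"
  let ?f = "\<lambda>w. qpoch_inf (A * q * w) q * qpoch_inf (q ^ 2 * w) q"
  have n1: "A * w * q ^ (j + 1) \<noteq> 1" "w * q ^ (j + 2) \<noteq> 1" if "w \<in> {0, x, y, z, v}" for w j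
    using that nz[of w j] nz'[of w j] by auto
  have e1: "?f x * qpoch_inf (q * A ^ 2 * x * y * z * v) q * ?B x y z v
      = qpoch_inf (A * q * x * y) q * qpoch_inf (A * q * x * z) q * qpoch_inf (A * q * x * v) q * ?B 0 y z v"
    by (rule bilateral_vwp_eliminate[OF q A nz nz' conv])
  have "?f y * qpoch_inf (q * A ^ 2 * y * 0 * z * v) q * ?B y 0 z v
      = qpoch_inf (A * q * y * 0) q * qpoch_inf (A * q * y * z) q * qpoch_inf (A * q * y * v) q * ?B 0 0 z v"
    by (rule bilateral_vwp_eliminate[OF q A]) (use n1 in auto)
  then have e2: "?f y * ?B 0 y z v = qpoch_inf (A * q * y * z) q * qpoch_inf (A * q * y * v) q * ?B 0 0 z v"
    by (simp add: bilateral_vwp_swap(1)[of q A y])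
  have "?f z * qpoch_inf (q * A ^ 2 * z * 0 * 0 * v) q * ?B z 0 0 v
      = qpoch_inf (A * q * z * 0) q * qpoch_inf (A * q * z * 0) q * qpoch_inf (A * q * z * v) q * ?B 0 0 0 v"
    by (rule bilateral_vwp_eliminate[OF q A]) (use n1 in auto)
  then have e3: "?f z * ?B 0 0 z v = qpoch_inf (A * q * z * v) q * ?B 0 0 0 v"
    by (simp add: bilateral_vwp_swap(2)[of q A z])
  have "?f v * qpoch_inf (q * A ^ 2 * v * 0 * 0 * 0) q * ?B v 0 0 0
      = qpoch_inf (A * q * v * 0) q * qpoch_inf (A * q * v * 0) q * qpoch_inf (A * q * v * 0) q * ?B 0 0 0 0"
    by (rule bilateral_vwp_eliminate[OF q A]) (use n1 in auto)
  then have e4: "?f v * ?B 0 0 0 v = ?B 0 0 0 0"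
    by (simp add: bilateral_vwp_swap(3)[of q A v])
  have "?f x * ?f y * ?f z * ?f v * qpoch_inf (q * A ^ 2 * x * y * z * v) q * ?B x y z v
     = ?f y * ?f z * ?f v * (?f x * qpoch_inf (q * A ^ 2 * x * y * z * v) q * ?B x y z v)"
    by (simp only: mult_ac)
  also have "\<dots> = qpoch_inf (A * q * x * y) q * qpoch_inf (A * q * x * z) q * qpoch_inf (A * q * x * v) q
      * (?f z * ?f v * (?f y * ?B 0 y z v))"
    unfolding e1 by (simp only: mult_ac)
  also have "?f z * ?f v * (?f y * ?B 0 y z v)
      = qpoch_inf (A * q * y * z) q * qpoch_inf (A * q * y * v) q * (?f v * (?f z * ?B 0 0 z v))"
    unfolding e2 by (simp only: mult_ac)
  also have "?f v * (?f z * ?B 0 0 z v) = qpoch_inf (A * q * z * v) q * ?B 0 0 0 0"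
    unfolding e3 e4[symmetric] by (simp only: mult_ac)
  finally show ?thesis by (simp only: mult_ac)
qed

subsection \<open>The theta series\<close>

text \<open>The m-th term is (-A)^m q^(m(m-1)/2), written as a product to avoid the halved
  exponent.\<close>

definition partial_theta :: "complex \<Rightarrow> complex \<Rightarrow> complex" where
  "partial_theta q A = (\<Sum>m. \<Prod>j<m. - (A * q ^ j))"

lemma summable_partial_theta:
  fixes q A :: complex
  assumes q: "norm q < 1"
  shows "summable (\<lambda>m. \<Prod>j<m. - (A * q ^ j))"
proof -
  have "(\<lambda>n. norm (A * q ^ n)) \<longlonglongrightarrow> 0"
    by (intro tendsto_norm_zero tendsto_mult_right_zero LIMSEQ_power_zero q)
  then have "eventually (\<lambda>n. norm (A * q ^ n) < 1 / 2) sequentially"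
    by (rule order_tendstoD) simp
  then obtain N where N: "\<And>n. n \<ge> N \<Longrightarrow> norm (A * q ^ n) < 1 / 2"
    unfolding eventually_sequentially by blast
  show ?thesis
  proof (rule summable_ratio_test[of "1 / 2" N])
    fix n assume "n \<ge> N"
    then show "norm (\<Prod>j<Suc n. - (A * q ^ j)) \<le> 1 / 2 * norm (\<Prod>j<n. - (A * q ^ j))"
      using mult_right_mono[OF less_imp_le[OF N], of n "norm (\<Prod>j<n. - (A * q ^ j))"]
      by (simp add: norm_mult mult_ac)
  qed simp
qed

lemma partial_theta_rec:
  assumes q: "norm q < 1"
  shows "partial_theta q A = 1 - A * partial_theta q (A * q)"
proof -
  let ?e = "\<lambda>A m. \<Prod>j<m. - (A * q ^ j)"
  have "?e A (Suc m) = - A * ?e (A * q) m" for m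
    by (subst prod.lessThan_Suc_shift) (simp add: mult.assoc)
  then have "(\<Sum>m. ?e A (Suc m)) = (\<Sum>m. - A * ?e (A * q) m)"
    by (rule suminf_cong)
  also have "\<dots> = - A * partial_theta q (A * q)"
    unfolding partial_theta_def by (rule suminf_mult[OF summable_partial_theta[OF q]])
  also have "(\<Sum>m. ?e A (Suc m)) = partial_theta q A - ?e A 0"
    unfolding partial_theta_def by (rule suminf_split_head[OF summable_partial_theta[OF q]])
  finally show ?thesis by (simp add: algebra_simps)
qed

text \<open>The n-th weight is the theta term of index 2n, and the factor 1 - Aq^(2n) adds the term
  of index 2n + 1. The series is therefore the partial theta series grouped in pairs.\<close>

lemma vwp_sum_zeros:
  assumes q: "norm q < 1"
  shows "vwp_sum q A 0 0 0 0 = partial_theta q A"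
proof -
  let ?e = "\<lambda>m. \<Prod>j<m. - (A * q ^ j)"
  have e: "(q * A ^ 2) ^ n * (\<Prod>j<n. - (q ^ j)) * (\<Prod>j<n. - (q ^ j)) * (\<Prod>j<n. - (q ^ j))
      * (\<Prod>j<n. - (q ^ j)) = ?e (n * 2)" for n
  proof (induction n)
    case (Suc n)
    have "?e (Suc n * 2) = ?e (n * 2) * (q * A ^ 2 * (q ^ n) ^ 4)"
      by (simp add: power2_eq_square power4_eq_xxxx power_add power_mult mult_ac)
    then show ?case
      unfolding Suc[symmetric]
      by (simp only: prod.lessThan_Suc power_Suc power4_eq_xxxx mult_minus_left mult_minus_right
          minus_minus mult_ac)
  qed simp
  have "(1 - A * q ^ (2 * n)) * vwp_weight q A 0 0 0 0 n = sum ?e {n * 2..<n * 2 + 2}" for n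
  proof -
    have "{n * 2..<n * 2 + 2} = {n * 2, Suc (n * 2)}" by auto
    then have "sum ?e {n * 2..<n * 2 + 2} = (1 - A * q ^ (2 * n)) * ?e (n * 2)"
      by (simp add: algebra_simps)
    then show ?thesis
      unfolding e[symmetric] by (simp add: vwp_weight_def well_poised_factor_def)
  qed
  moreover have "(\<lambda>n. sum ?e {n * 2..<n * 2 + 2}) sums partial_theta q A"
    unfolding partial_theta_def
    by (rule sums_group[OF summable_sums[OF summable_partial_theta[OF q]]]) simp
  ultimately show ?thesis
    unfolding vwp_sum_def by (simp add: sums_iff)
qed

text \<open>The right side is the theta series over all integers: its second part collects the
  indices -1 - m.\<close>

lemma bilateral_vwp_zeros:
  assumes q: "norm q < 1"
  shows "bilateral_vwp q A 0 0 0 0 = partial_theta q A - q / A * partial_theta q (q ^ 2 / A)"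
  by (simp add: bilateral_vwp_def vwp_sum_zeros[OF q])

text \<open>Quasi-periodicity, from moving the bilateral index by one. It carries the zero at A = 1
  to all integral powers of \<open>q\<close>.\<close>

lemma bilateral_vwp_zeros_shift:
  assumes q: "norm q < 1" "q \<noteq> 0" and A: "A \<noteq> 0"
  shows "bilateral_vwp q A 0 0 0 0 = - A * bilateral_vwp q (A * q) 0 0 0 0"
proof -
  have "partial_theta q (q / A) = 1 - q / A * partial_theta q (q ^ 2 / A)"
    using partial_theta_rec[OF q(1), of "q / A"] by (simp add: power2_eq_square)
  moreover have "q ^ 2 / (A * q) = q / A" "q / (A * q) = 1 / A"
    using q by (simp_all add: power2_eq_square)
  ultimately show ?thesis
    unfolding bilateral_vwp_zeros[OF q(1)] using partial_theta_rec[OF q(1), of A] A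
    by (simp add: algebra_simps)
qed

text \<open>By the recursion at 1 and at \<open>q\<close>, both \<open>partial_theta q 1\<close> and
  \<open>q * partial_theta q (q ^ 2)\<close> equal \<open>1 - partial_theta q q\<close>.\<close>

lemma bilateral_vwp_zeros_1:
  assumes q: "norm q < 1"
  shows "bilateral_vwp q 1 0 0 0 0 = 0"
  using partial_theta_rec[OF q, of 1] partial_theta_rec[OF q, of q]
  by (simp add: bilateral_vwp_zeros[OF q] power2_eq_square)

text \<open>
  Jacobi's triple product. For the parameters \<open>(1, 1/A, 0, 0)\<close> one of the two series has the single
  term \<open>1 - A\<close> and the other one is multiplied by \<open>0\<close>. This breaks down only if \<open>A\<close> is a power of \<open>q\<close>,
  where both sides vanish.
\<close>
lemma bilateral_vwp_zeros_eq:
  assumes q: "0 < norm q" "norm q < 1" and A: "A \<noteq> 0"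
  shows "bilateral_vwp q A 0 0 0 0 = qpoch_inf q q * qpoch_inf A q * qpoch_inf (q / A) q"
proof -
  have q0: "q \<noteq> 0" using q by auto
  have q1: "q ^ (j + 1) \<noteq> 1" for j
  proof -
    have "norm (q ^ (j + 1)) < 1" using q power_Suc_less_one[of "norm q" j] by (simp add: norm_mult norm_power)
    then show ?thesis by force
  qed
  \<comment> \<open>The first two cases are those where a denominator for the parameters (1, 1/A, 0,
    0) vanishes. The values A = 1 and A = q are not among them and belong to the generic
    case.\<close>
  consider (neg) j where "A * q ^ (j + 1) = 1" | (pos) j where "A = q ^ (j + 2)"
    | (generic) "\<And>j. A * q ^ (j + 1) \<noteq> 1" "\<And>j. A \<noteq> q ^ (j + 2)"
    by blast
  then show ?thesis
  proof cases
    case (neg j)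
    have "B \<noteq> 0 \<Longrightarrow> B * q ^ n = 1 \<Longrightarrow> bilateral_vwp q B 0 0 0 0 = 0" for B n
    proof (induction n arbitrary: B)
      case 0
      then show ?case using bilateral_vwp_zeros_1[OF q(2)] by simp
    next
      case (Suc n)
      then have "bilateral_vwp q (B * q) 0 0 0 0 = 0" using q0 by (simp add: mult.assoc)
      then show ?case using bilateral_vwp_zeros_shift[OF q(2) q0 Suc.prems(1)] by simp
    qed
    from this[OF A neg] show ?thesis using qpoch_inf_eq_0[OF q(2) neg] by simp
  next
    case (pos j)
    have B: "bilateral_vwp q (q ^ n) 0 0 0 0 = 0" for n
    proof (induction n)
      case 0
      then show ?case using bilateral_vwp_zeros_1[OF q(2)] by simp
    next
      case (Suc n)
      then show ?case
        using bilateral_vwp_zeros_shift[OF q(2) q0, of "q ^ n"] q0 by (simp add: mult.commute)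
    qed
    have "q / A * q ^ (j + 1) = 1" using pos q0 by simp
    then have "qpoch_inf (q / A) q = 0" by (rule qpoch_inf_eq_0[OF q(2)])
    then show ?thesis unfolding pos B by simp
  next
    case generic
    have n1: "A * w * q ^ (j + 1) \<noteq> 1" if "w \<in> {1, 1 / A, 0, 0}" for w j
      using that generic(1)[of j] q1[of j] A by auto
    have n2: "w * q ^ (j + 2) \<noteq> 1" if "w \<in> {1, 1 / A, 0, 0}" for w j
      using that generic(2)[of j] q1[of "j + 1"] A by auto
    \<comment> \<open>The parameter 1 makes the numerator factor with j = 0 vanish.\<close>
    have "well_poised_factor q A 1 n = 0" if "n \<notin> {0}" for n
      unfolding well_poised_factor_def using that by (intro prod_zero) (auto intro!: bexI[of _ 0])
    then have "vwp_weight q A 1 (1 / A) 0 0 n = 0" if "n \<notin> {0}" for n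
      using that by (simp add: vwp_weight_def)
    then have "vwp_sum q A 1 (1 / A) 0 0 = 1 - A"
      unfolding vwp_sum_def by (subst suminf_finite[of "{0}"]) (auto simp: vwp_weight_def)
    then have B: "bilateral_vwp q A 1 (1 / A) 0 0 = (1 - q) * (1 - q / A) * (1 - A)"
      using A by (simp add: bilateral_vwp_def)
    have "qpoch_inf (A * q) q * qpoch_inf (q ^ 2) q * (qpoch_inf q q * qpoch_inf (q ^ 2 / A) q)
        * bilateral_vwp q A 1 (1 / A) 0 0 = qpoch_inf q q * bilateral_vwp q A 0 0 0 0"
      using bilateral_vwp_reduce[of q A 1 "1 / A" 0 0, OF q A n1 n2] A by simp
    \<comment> \<open>With x = 1 and y = 1/A both Aqy and Aqxy equal \<open>q\<close>, so (q;q)_inf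
      cancels; the three linear factors then complete the remaining products.\<close>
    moreover have "qpoch_inf q q \<noteq> 0"
      using q1 by (intro qpoch_inf_nonzero q) simp
    ultimately have "bilateral_vwp q A 0 0 0 0
        = ((1 - q) * qpoch_inf (q * q) q) * ((1 - A) * qpoch_inf (A * q) q)
          * ((1 - q / A) * qpoch_inf (q / A * q) q)"
      unfolding B by (simp add: power2_eq_square mult_ac)
    then show ?thesis
      using qpoch_inf_rec[OF q(2), of q] qpoch_inf_rec[OF q(2), of A] qpoch_inf_rec[OF q(2), of "q / A"]
      by simp
  qed
qed

subsection \<open>Bailey's summation and the reciprocity theorem\<close>

text \<open>
  With \<open>A = aq/b\<close> and the parameters \<open>-b/q, -c/(aq), -d/(aq), -e/(aq)\<close>; the factors \<open>x - q\<^sup>j\<close> in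
  \<^const>\<open>well_poised_factor\<close> are \<open>x (1 - q\<^sup>j / x)\<close>, and the powers of \<open>x\<close> combine to the argument of the series.
\<close>
lemma rho_eq_vwp_sum:
  assumes "q \<noteq> 0" "a \<noteq> 0" "b \<noteq> 0" "c \<noteq> 0" "d \<noteq> 0" "e \<noteq> 0" and q: "norm q < 1"
    and nz: "\<And>w j. w \<in> {- b / q, - c / (a * q), - d / (a * q), - e / (a * q)} \<Longrightarrow> a * q / b * w * q ^ (j + 1) \<noteq> 1"
    and conv: "norm (c * d * e) < norm (a * b * q)"
  shows "rho q a b c d e = (1 + 1 / b) / ((1 + c / b) * (1 + d / b) * (1 + e / b))
     * vwp_sum q (a * q / b) (- b / q) (- c / (a * q)) (- d / (a * q)) (- e / (a * q))"
proof -
  have p: "(\<Prod>j<n. w - q ^ j) = w ^ n * qpoch (1 / w) q n" if "w \<noteq> 0" for w n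
  proof -
    have "w - q ^ j = w * (1 - 1 / w * q ^ j)" for j using that by (simp add: right_diff_distrib)
    then show ?thesis unfolding qpoch_def by (simp add: prod.distrib)
  qed
  let ?A = "a * q / b"
  have W: "q * ?A ^ 2 * (- b / q) * (- c / (a * q)) * (- d / (a * q)) * (- e / (a * q)) = c * d * e / (a * b * q)"
    using assms(1-6) by (simp add: field_simps power2_eq_square)
  have wpf: "well_poised_factor q ?A w n = w ^ n * (qpoch (1 / w) q n / qpoch (?A * w * q) q n)"
    if "w \<noteq> 0" for w n
    using p[OF that] by (simp add: well_poised_factor_eq)
  have t: "(1 - a * q ^ (2 * k + 1) / b)
          * (qpoch (-1 / b) q (k + 1) / qpochs [- c / b, - d / b, - e / b] q (k + 1))
          * (qpochs [- a * q / c, - a * q / d, - a * q / e] q k / qpoch (- a * q) q k)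
          * (c * d * e / (a * b * q)) ^ k
       = (1 + 1 / b) / ((1 + c / b) * (1 + d / b) * (1 + e / b))
          * ((1 - ?A * q ^ (2 * k)) * vwp_weight q ?A (- b / q) (- c / (a * q)) (- d / (a * q)) (- e / (a * q)) k)" for k
  proof -
    let ?w = "\<lambda>u. qpoch (- a * q / u) q k" and ?d = "\<lambda>u. qpoch (- u / b * q) q k"
    have s: "1 / (- u / (a * q)) = - a * q / u" "?A * (- u / (a * q)) * q = - u / b * q" for u
      using assms(1-6) by auto
    have s1: "1 / (- b / q) = - 1 / b * q" "?A * (- b / q) * q = - a * q"
      using assms(1-6) by auto
    have nzs: "- b / q \<noteq> 0" "- c / (a * q) \<noteq> 0" "- d / (a * q) \<noteq> 0" "- e / (a * q) \<noteq> 0"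
      using assms(1-6) by auto
    have "vwp_weight q ?A (- b / q) (- c / (a * q)) (- d / (a * q)) (- e / (a * q)) k
      = (q * ?A ^ 2 * (- b / q) * (- c / (a * q)) * (- d / (a * q)) * (- e / (a * q))) ^ k
        * (qpoch (- 1 / b * q) q k / qpoch (- a * q) q k) * (?w c / ?d c) * (?w d / ?d d) * (?w e / ?d e)"
      unfolding vwp_weight_def wpf[OF nzs(1)] wpf[OF nzs(2)] wpf[OF nzs(3)] wpf[OF nzs(4)] s s1
        power_mult_distrib by (simp only: mult_ac)
    \<comment> \<open>The symbols of length k + 1 shed their factors with j = 0. These form the
      constant in front of the series and leave symbols of length k with arguments multiplied by
      \<open>q\<close>.\<close>
    moreover have "qpoch (-1 / b) q (k + 1) = (1 + 1 / b) * qpoch (- 1 / b * q) q k"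
      by (simp add: qpoch_Suc_left)
    moreover have "qpochs [- c / b, - d / b, - e / b] q (k + 1)
        = (1 + c / b) * (1 + d / b) * (1 + e / b) * (?d c * ?d d * ?d e)"
      by (simp add: qpochs_def qpoch_Suc_left)
    moreover have "qpochs [- a * q / c, - a * q / d, - a * q / e] q k = ?w c * ?w d * ?w e"
      by (simp add: qpochs_def)
    moreover have "a * q ^ (2 * k + 1) / b = ?A * q ^ (2 * k)" by simp
    ultimately show ?thesis
      unfolding W
      by (simp only: times_divide_times_eq times_divide_eq_left times_divide_eq_right divide_divide_eq_left mult_ac)
  qed
  have conv': "norm (q * ?A ^ 2 * (- b / q) * (- c / (a * q)) * (- d / (a * q)) * (- e / (a * q))) < 1"
    unfolding W using conv assms(1-6) by (simp add: norm_divide)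
  have "summable (\<lambda>k. (1 - ?A * q ^ (2 * k))
      * vwp_weight q ?A (- b / q) (- c / (a * q)) (- d / (a * q)) (- e / (a * q)) k)"
    using assms(1) by (intro summable_vwp[OF _ q nz conv']) auto
  then show ?thesis
    unfolding rho_def t vwp_sum_def by (rule suminf_mult)
qed

theorem theorem1p3:
  fixes q a b c d e :: complex
  assumes "0 < norm q" and "norm q < 1"
    and "0 < norm (c * d * e)" and "norm (c * d * e) < norm (a * b * q)"
    and "\<And>m n :: nat. \<forall>x \<in> {c, d, e}. x \<noteq> - a * q powi (- int m) \<and> x \<noteq> - b * q powi (- int n)"
    \<comment> \<open>the factors \<open>(-aq;q)\<^sub>k\<close> and \<open>(-bq;q)\<^sub>k\<close> in the denominators do not vanish\<close>
    and "\<And>n :: nat. n \<ge> 1 \<Longrightarrow> a \<noteq> - (q powi (- int n)) \<and> b \<noteq> - (q powi (- int n))"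
  shows "rho q a b c d e - rho q b a c d e =
    (1 / b - 1 / a)
    * (qpochs_inf [q, a * q / b, b * q / a, c, d, e, c * d / (a * b), c * e / (a * b), d * e / (a * b)] q
       / qpochs_inf [- a * q, - b * q, - c / a, - c / b, - d / a, - d / b, - e / a, - e / b,
                     c * d * e / (a * b * q)] q)"
proof -
  have q: "0 < norm q" "norm q < 1" and q0: "q \<noteq> 0" using assms(1,2) by auto
  have "norm (a * b * q) > 0" using assms(3,4) by linarith
  then have nonzero: "a \<noteq> 0" "b \<noteq> 0" "c \<noteq> 0" "d \<noteq> 0" "e \<noteq> 0" using assms(3) by auto
  have powi: "q powi (- int n) * q ^ n = 1" for n
    using q0 by (simp add: power_int_minus)
  have ha: "- a * q ^ (j + 1) \<noteq> 1" and hb: "- b * q ^ (j + 1) \<noteq> 1" for j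
  proof -
    have "t = - (q powi (- int (j + 1)))" if "- t * q ^ (j + 1) = 1" for t
      using that powi[of "j + 1"] q0
      by (metis minus_minus mult_cancel_right power_not_zero)
    then show "- a * q ^ (j + 1) \<noteq> 1" "- b * q ^ (j + 1) \<noteq> 1"
      using assms(6)[of "j + 1"] by auto
  qed
  have hu: "- u / a * q ^ j \<noteq> 1" "- u / b * q ^ j \<noteq> 1" if "u \<in> {c, d, e}" for u j
  proof -
    have "u = - t * q powi (- int j)" if "- u / t * q ^ j = 1" "t \<noteq> 0" for t
    proof -
      have "- u / t * q ^ j = q powi (- int j) * q ^ j" using that(1) powi[of j] by simp
      then have "- u / t = q powi (- int j)"
        by (rule mult_right_cancel[THEN iffD1, rotated]) (use q0 in simp)
      then have "- u = t * q powi (- int j)" using that(2) by (simp add: field_simps)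
      then show ?thesis by (metis minus_minus mult_minus_left)
    qed
    then show "- u / a * q ^ j \<noteq> 1" "- u / b * q ^ j \<noteq> 1"
      using assms(5)[of j j] that nonzero by blast+
  qed
  define A where "A = a * q / b"
  define x y z v where "x = - b / q" and "y = - c / (a * q)" and "z = - d / (a * q)" and "v = - e / (a * q)"
  note defs = A_def x_def y_def z_def v_def
  have A0: "A \<noteq> 0" using nonzero q0 by (simp add: A_def)
  have conv: "norm (q * A ^ 2 * x * y * z * v) < 1"
  proof -
    have "q * A ^ 2 * x * y * z * v = c * d * e / (a * b * q)"
      using nonzero q0 by (simp add: defs field_simps power2_eq_square)
    then show ?thesis using assms(4) nonzero q0 by (simp add: norm_divide)
  qed
  have nz: "A * w * q ^ (j + 1) \<noteq> 1" if "w \<in> {x, y, z, v}" for w j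
  proof -
    have "A * w * q ^ (j + 1) \<in> {- a * q ^ (j + 1), - c / b * q ^ (j + 1), - d / b * q ^ (j + 1), - e / b * q ^ (j + 1)}"
      using that nonzero q0 by (auto simp: defs)
    then show ?thesis using ha[of j] hu(2)[of _ "j + 1"] by (metis insert_iff singletonD)
  qed
  have nz': "w * q ^ (j + 2) \<noteq> 1" if "w \<in> {x, y, z, v}" for w j
  proof -
    have "w * q ^ (j + 2) \<in> {- b * q ^ (j + 1), - c / a * q ^ (j + 1), - d / a * q ^ (j + 1), - e / a * q ^ (j + 1)}"
      using that nonzero q0 by (auto simp: defs)
    then show ?thesis using hb[of j] hu(1)[of _ "j + 1"] by (metis insert_iff singletonD)
  qed
  let ?Kb = "(1 + c / b) * (1 + d / b) * (1 + e / b)" and ?Ka = "(1 + c / a) * (1 + d / a) * (1 + e / a)"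
  have rho1: "rho q a b c d e = (1 + 1 / b) / ?Kb * vwp_sum q A x y z v"
    unfolding defs
    by (rule rho_eq_vwp_sum) (use nonzero q0 q assms(4) nz in \<open>simp_all add: defs\<close>)
  \<comment> \<open>In these parameters the reflection is the exchange of \<open>a\<close> and
    \<open>b\<close>.\<close>
  have swap: "q ^ 2 / A = b * q / a" "x * A / q = - a / q" "y * A / q = - c / (b * q)"
      "z * A / q = - d / (b * q)" "v * A / q = - e / (b * q)"
    using nonzero q0 by (auto simp: defs power2_eq_square)
  have nz2: "b * q / a * u * q ^ (j + 1) \<noteq> 1"
    if "u \<in> {- a / q, - c / (b * q), - d / (b * q), - e / (b * q)}" for u j
  proof -
    have "b * q / a * u * q ^ (j + 1) \<in> {- b * q ^ (j + 1), - c / a * q ^ (j + 1), - d / a * q ^ (j + 1), - e / a * q ^ (j + 1)}"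
      using that nonzero q0 by auto
    then show ?thesis using hb[of j] hu(1)[of _ "j + 1"] by (metis insert_iff singletonD)
  qed
  have rho2: "rho q b a c d e = (1 + 1 / a) / ?Ka
      * vwp_sum q (q ^ 2 / A) (x * A / q) (y * A / q) (z * A / q) (v * A / q)"
    unfolding swap
    by (rule rho_eq_vwp_sum[OF q0 nonzero(2,1,3-5) q(2) nz2]) (use assms(4) in \<open>simp_all add: mult_ac\<close>)
  \<comment> \<open>The case j = 0 of \<open>hu\<close>.\<close>
  have K: "?Ka \<noteq> 0" "?Kb \<noteq> 0"
    using hu[of c 0] hu[of d 0] hu[of e 0] by (auto simp: add_eq_0_iff2)
  have f: "1 - q * x = 1 + b" "1 - q * y = 1 + c / a" "1 - q * z = 1 + d / a" "1 - q * v = 1 + e / a"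
      "1 - A * x = 1 + a" "1 - A * y = 1 + c / b" "1 - A * z = 1 + d / b" "1 - A * v = 1 + e / b"
      "q / A = b / a"
    using nonzero q0 by (auto simp: defs)
  \<comment> \<open>The prefactors (1 + b) Ka and (b/a)(1 + a) Kb of the two halves, divided by b Ka
    Kb, are (1 + 1/b)/Kb and (1 + 1/a)/Ka.\<close>
  have diff: "rho q a b c d e - rho q b a c d e = 1 / b / (?Ka * ?Kb) * bilateral_vwp q A x y z v"
  proof -
    define Ka where "Ka = ?Ka"
    define Kb where "Kb = ?Kb"
    define S where "S = vwp_sum q A x y z v"
    define T where "T = vwp_sum q (q ^ 2 / A) (x * A / q) (y * A / q) (z * A / q) (v * A / q)"
    have bil: "bilateral_vwp q A x y z v = (1 + b) * Ka * S - b / a * ((1 + a) * Kb * T)"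
      unfolding bilateral_vwp_def f S_def T_def Ka_def Kb_def by (simp only: mult_ac)
    have "Ka \<noteq> 0" "Kb \<noteq> 0" using K by (auto simp: Ka_def Kb_def)
    then show ?thesis
      unfolding bil rho1 rho2 Ka_def[symmetric] Kb_def[symmetric] S_def[symmetric] T_def[symmetric]
      using nonzero by (simp add: field_simps)
  qed
  let ?P = "\<lambda>w. qpoch_inf w q"
  have arg: "A * q * x = - a * q" "q ^ 2 * x = - b * q"
      "A * q * y = - c / b * q" "q ^ 2 * y = - c / a * q"
      "A * q * z = - d / b * q" "q ^ 2 * z = - d / a * q"
      "A * q * v = - e / b * q" "q ^ 2 * v = - e / a * q"
    and arg2: "A * q * x * y = c" "A * q * x * z = d" "A * q * x * v = e"
      "A * q * y * z = c * d / (a * b)" "A * q * y * v = c * e / (a * b)" "A * q * z * v = d * e / (a * b)"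
      "q * A ^ 2 * x * y * z * v = c * d * e / (a * b * q)" "q / A = b / a"
    using nonzero q0 by (simp_all add: defs field_simps power2_eq_square)
  \<comment> \<open>\<open>D\<close> is the denominator of the claim without the first factors of
    the six products in -u/a and -u/b; those factors make up \<open>?Ka * ?Kb\<close>.\<close>
  define D where "D = ?P (- a * q) * ?P (- b * q) * (?P (- c / b * q) * ?P (- c / a * q))
      * (?P (- d / b * q) * ?P (- d / a * q)) * (?P (- e / b * q) * ?P (- e / a * q)) * ?P (c * d * e / (a * b * q))"
  define N where "N = ?P c * ?P d * ?P e * ?P (c * d / (a * b)) * ?P (c * e / (a * b)) * ?P (d * e / (a * b))
      * (?P q * ?P (a * q / b) * ?P (b * q / a))"
  have "D * bilateral_vwp q A x y z v = ?P c * ?P d * ?P e * ?P (c * d / (a * b)) * ?P (c * e / (a * b))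
      * ?P (d * e / (a * b)) * (?P q * ?P A * ?P (b / a))"
    using bilateral_vwp_reduce[OF q A0 nz nz' conv]
    unfolding arg2 unfolding arg bilateral_vwp_zeros_eq[OF q A0] arg2(8) D_def .
  \<comment> \<open>The theta product contains (b/a;q)_inf. Its first factor, times the 1/b of
    \<open>diff\<close>, becomes 1/b - 1/a.\<close>
  also have "?P (b / a) = (1 - b / a) * ?P (b * q / a)"
    using qpoch_inf_rec[OF q(2), of "b / a"] by simp
  finally have B: "D * bilateral_vwp q A x y z v = (1 - b / a) * N"
    unfolding N_def A_def by (simp only: mult_ac)
  have "norm (c * d * e / (a * b * q) * q ^ j) < 1" for j
  proof -
    have "norm (c * d * e / (a * b * q) * q ^ j) \<le> norm (c * d * e / (a * b * q))"
      unfolding norm_mult[of _ "q ^ j"] norm_power using q by (intro mult_left_le power_le_one) auto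
    also have "\<dots> < 1" using conv arg2(7) by simp
    finally show ?thesis .
  qed
  then have "?P (c * d * e / (a * b * q)) \<noteq> 0"
    by (intro qpoch_inf_nonzero q) (metis less_irrefl norm_one)
  moreover have "?P (- a * q) \<noteq> 0" "?P (- b * q) \<noteq> 0"
    by (intro qpoch_inf_nonzero q; use ha hb in \<open>simp add: mult_ac\<close>)+
  moreover have "?P (- u / a * q) \<noteq> 0" "?P (- u / b * q) \<noteq> 0" if "u \<in> {c, d, e}" for u
    using hu[OF that, of "Suc _"] by (intro qpoch_inf_nonzero q; simp add: mult_ac)+
  ultimately have D0: "D \<noteq> 0" unfolding D_def by simp
  have rec: "?P (- u) = (1 + u) * ?P (- u * q)" for u
    using qpoch_inf_rec[OF q(2), of "- u"] by simp
  have den: "qpochs_inf [- a * q, - b * q, - c / a, - c / b, - d / a, - d / b, - e / a, - e / b,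
                     c * d * e / (a * b * q)] q = ?Ka * ?Kb * D"
    unfolding qpochs_inf_def D_def
    using rec[of "c / a"] rec[of "c / b"] rec[of "d / a"] rec[of "d / b"] rec[of "e / a"] rec[of "e / b"]
    by (simp add: mult_ac)
  have num: "qpochs_inf [q, a * q / b, b * q / a, c, d, e, c * d / (a * b), c * e / (a * b), d * e / (a * b)] q = N"
    unfolding qpochs_inf_def N_def by (simp add: mult_ac)
  have "bilateral_vwp q A x y z v = (1 - b / a) * N / D"
    using B D0 by (simp add: field_simps)
  then have "rho q a b c d e - rho q b a c d e = (1 / b * (1 - b / a)) * (N / (?Ka * ?Kb * D))"
    unfolding diff by (simp only: times_divide_times_eq times_divide_eq_left times_divide_eq_right
        divide_divide_eq_left mult_ac)
  also have "1 / b * (1 - b / a) = 1 / b - 1 / a"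
    using nonzero by (simp add: right_diff_distrib)
  finally show ?thesis unfolding den num .
qed

end
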